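(* Let $U\in \mathcal B(\mathcal H)$ with $\|U\|<\frac{\sqrt{2}}{2}$, let $\mathcal H_n$ be invariant for $U$ for every $n\in\mathbb N$, and let $\Lambda_n\in\mathcal B(\mathcal H,\mathcal H_n)$ for all $n\in\mathbb N$. The following are equivalent. (i) $\{\Lambda_n\}_{n\in\mathbb N}$ is an $E$-$g$-frame for $\mathcal H$. (ii) For each $m\in\mathbb N$, the sequence $\{\Lambda_n+U^m\Lambda_n\}_{n\in\mathbb N}$ is an $E$-$g$-frame for $\mathcal H$. (iii) There exists $m\in\mathbb N$ such that $\{\Lambda_n+U^m\Lambda_n\}_{n\in\mathbb N}$ is an $E$-$g$-frame for $\mathcal H$.
   Context: $\mathcal H$ is an infinite-dimensional separable Hilbert space, $\{\mathcal H_n\}_{n\in\mathbb N}$ is a sequence of closed subspaces of $\mathcal H$, and $\mathcal B(\mathcal H,\mathcal H_n)$ is the space of bounded linear operators from $\mathcal H$ into $\mathcal H_n$; $\mathcal B(\mathcal H)=\mathcal B(\mathcal H,\mathcal H)$. The space $(\oplus_{n=1}^{\infty}\mathcal H_n)_{\ell^2}$ consists of all sequences $\{f_n\}_{n=1}^\infty$ with $f_n\in\mathcal H_n$ and $\sum_{n=1}^\infty\|f_n\|^2<\infty$; it is a Hilbert space with inner product $\langle\{f_n\},\{g_n\}\rangle=\sum_{n=1}^{\infty}\langle f_n,g_n\rangle$. $E=(E_{n,k})_{n,k\ge1}$ is an infinite matrix of real or complex numbers which is an invertible matrix mapping on $(\oplus_{n=1}^{\infty}\mathcal H_n)_{\ell^2}$,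 where a matrix mapping sends a sequence $x=\{x_n\}_{n=1}^\infty$ to the sequence $Ex=\{(Ex)_n\}_{n=1}^\infty$ with $(Ex)_n=\sum_{k=1}^{\infty}E_{n,k}x_k$. A sequence $\{\Lambda_n\}_{n\in\mathbb N}$ with $\Lambda_n\in\mathcal B(\mathcal H,\mathcal H_n)$ is an $E$-$g$-frame for $\mathcal H$ if there exist positive real numbers $A,B$ (called $E$-$g$-frame bounds) such that $A\|f\|^2\leq \sum_{n=1}^{\infty}\left\|\sum_{k=1}^{\infty}E_{n,k}\Lambda_kf\right\|^2\leq B\|f\|^2$ for all $f\in \mathcal H$. A subspace $M$ of $\mathcal H$ is invariant for $U\in\mathcal B(\mathcal H)$ if $Uf\in M$ whenever $f\in M$. *)

theory Defs
  imports "HOL-Analysis.Analysis"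
begin

text \<open>
  Scalar fields: a commutative normed field over the reals with a conjugation satisfying
  \<open>x * rcnj x = \<bar>x\<bar>\<^sup>2\<close>.  Up to isomorphism these are exactly the reals and the complex
  numbers, so that real and complex Hilbert spaces are treated uniformly.
\<close>

class rc_field = real_normed_field +
  fixes rcnj :: "'a \<Rightarrow> 'a"
  assumes rcnj_add: "rcnj (x + y) = rcnj x + rcnj y"
    and rcnj_mult: "rcnj (x * y) = rcnj x * rcnj y"
    and mult_rcnj: "x * rcnj x = (norm x)\<^sup>2 *\<^sub>R 1"

instantiation real :: rc_field
begin

definition rcnj_real :: "real \<Rightarrow> real" where
  "rcnj_real x = x"

instance
  by standard (simp_all add: rcnj_real_def power2_eq_square)

end

instantiation complex :: rc_field
begin

definition rcnj_complex :: "complex \<Rightarrow> complex" where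
  "rcnj_complex = cnj"

instance
  by standard
    (simp_all add: rcnj_complex_def scaleR_conv_of_real complex_norm_square del: of_real_power)

end

text \<open>
  The norm and the topology of the type are those induced by the inner product \<open>ip\<close>,
  which is linear in its first argument; completeness comes from the class \<open>banach\<close>.
\<close>

locale hilbert_space = vector_space smul
  for smul :: "'k::rc_field \<Rightarrow> 'h::banach \<Rightarrow> 'h" +
  fixes ip :: "'h \<Rightarrow> 'h \<Rightarrow> 'k"
  assumes smul_of_real: "smul (of_real r) x = r *\<^sub>R x"
    and ip_add_left: "ip (x + y) z = ip x z + ip y z"
    and ip_smul_left: "ip (smul c x) y = c * ip x y"
    and ip_commute: "ip y x = rcnj (ip x y)"
    and ip_self: "ip x x = of_real ((norm x)\<^sup>2)"

lemma hilbert_space_inner: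
  "hilbert_space (scaleR :: real \<Rightarrow> 'h \<Rightarrow> 'h) (inner :: 'h::{real_inner, banach} \<Rightarrow> 'h \<Rightarrow> real)"
  by unfold_locales
    (simp_all add: inner_add_left rcnj_real_def inner_commute power2_norm_eq_inner algebra_simps)

lemma hilbert_space_complex: "hilbert_space (*) (\<lambda>x y :: complex. x * cnj y)"
  by unfold_locales
    (simp_all add: rcnj_complex_def scaleR_conv_of_real complex_norm_square algebra_simps
      del: of_real_power)

locale infinite_dim_separable_hilbert_space = hilbert_space smul ip
  for smul :: "'k::rc_field \<Rightarrow> 'h::banach \<Rightarrow> 'h" and ip :: "'h \<Rightarrow> 'h \<Rightarrow> 'k" +
  assumes infinite_dim: "\<nexists>B. finite B \<and> module.span smul B = UNIV"
    and separable: "\<exists>D :: 'h set. countable D \<and> closure D = UNIV"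

definition closed_subspace :: "('k::rc_field \<Rightarrow> 'h::banach \<Rightarrow> 'h) \<Rightarrow> 'h set \<Rightarrow> bool" where
  "closed_subspace smul M \<longleftrightarrow> module.subspace smul M \<and> closed M"

text \<open>
  Bounded linear operators from the whole space into \<open>M\<close>.  \<open>bounded_linear\<close> only covers real
  scalars, hence the additional linearity over the scalar field.
\<close>

definition bounded_ops ::
    "('k::rc_field \<Rightarrow> 'h::banach \<Rightarrow> 'h) \<Rightarrow> 'h set \<Rightarrow> ('h \<Rightarrow> 'h) set" where
  "bounded_ops smul M =
     {T. Vector_Spaces.linear smul smul T \<and> bounded_linear T \<and> range T \<subseteq> M}"

text \<open>Sequences are indexed by \<open>nat\<close>, i.e. from 0 instead of from 1.\<close>

definition l2_sum :: "(nat \<Rightarrow> 'h::banach set) \<Rightarrow> (nat \<Rightarrow> 'h) set" where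
  "l2_sum H = {x. (\<forall>n. x n \<in> H n) \<and> summable (\<lambda>n. (norm (x n))\<^sup>2)}"

definition matrix_map_defined ::
    "('k::rc_field \<Rightarrow> 'h::banach \<Rightarrow> 'h) \<Rightarrow> (nat \<Rightarrow> nat \<Rightarrow> 'k) \<Rightarrow> (nat \<Rightarrow> 'h) \<Rightarrow> bool" where
  "matrix_map_defined smul E x \<longleftrightarrow> (\<forall>n. summable (\<lambda>k. smul (E n k) (x k)))"

definition matrix_map ::
    "('k::rc_field \<Rightarrow> 'h::banach \<Rightarrow> 'h) \<Rightarrow> (nat \<Rightarrow> nat \<Rightarrow> 'k) \<Rightarrow> (nat \<Rightarrow> 'h) \<Rightarrow> nat \<Rightarrow> 'h" where
  "matrix_map smul E x n = (\<Sum>k. smul (E n k) (x k))"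

text \<open>
  Boundedness of the matrix mapping and of its inverse need not be demanded: both are automatic
  by the Banach-Steinhaus and open mapping theorems.
\<close>

definition invertible_matrix_map ::
    "('k::rc_field \<Rightarrow> 'h::banach \<Rightarrow> 'h) \<Rightarrow> (nat \<Rightarrow> 'h set) \<Rightarrow> (nat \<Rightarrow> nat \<Rightarrow> 'k) \<Rightarrow> bool" where
  "invertible_matrix_map smul H E \<longleftrightarrow>
     (\<forall>x\<in>l2_sum H. matrix_map_defined smul E x) \<and>
     bij_betw (matrix_map smul E) (l2_sum H) (l2_sum H)"

text \<open>
  The convergence of all series involved is stated explicitly, since \<open>suminf\<close> is a
  total function.
\<close>

definition E_g_frame ::
    "('k::rc_field \<Rightarrow> 'h::banach \<Rightarrow> 'h) \<Rightarrow> (nat \<Rightarrow> nat \<Rightarrow> 'k) \<Rightarrow> (nat \<Rightarrow> 'h set) \<Rightarrow>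
     (nat \<Rightarrow> 'h \<Rightarrow> 'h) \<Rightarrow> bool" where
  "E_g_frame smul E H \<Lambda> \<longleftrightarrow>
     (\<forall>n. \<Lambda> n \<in> bounded_ops smul (H n)) \<and>
     (\<exists>A>0. \<exists>B>0. \<forall>f.
        matrix_map_defined smul E (\<lambda>k. \<Lambda> k f) \<and>
        summable (\<lambda>n. (norm (matrix_map smul E (\<lambda>k. \<Lambda> k f) n))\<^sup>2) \<and>
        A * (norm f)\<^sup>2 \<le> (\<Sum>n. (norm (matrix_map smul E (\<lambda>k. \<Lambda> k f) n))\<^sup>2) \<and>
        (\<Sum>n. (norm (matrix_map smul E (\<lambda>k. \<Lambda> k f) n))\<^sup>2) \<le> B * (norm f)\<^sup>2)"

definition invariant_subspace :: "('h \<Rightarrow> 'h) \<Rightarrow> 'h set \<Rightarrow> bool" where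
  "invariant_subspace U M \<longleftrightarrow> (\<forall>f\<in>M. U f \<in> M)"

end

theory Submission imports Defs begin

text \<open>
  For \<open>m \<ge> 1\<close> the operator \<open>U ^^ m\<close> has norm at most \<open>\<parallel>U\<parallel>\<^sup>m \<le> \<parallel>U\<parallel> < 1\<close>, so \<open>T = I + U ^^ m\<close> is bounded
  and also bounded below: \<open>(1 - \<parallel>U\<parallel>) * \<parallel>y\<parallel> \<le> \<parallel>T y\<parallel>\<close>.  Being continuous and linear over the scalar field,
  \<open>T\<close> commutes with the infinite sums that define the matrix mapping, that is
  \<open>(E (T x))\<^sub>n = T ((E x)\<^sub>n)\<close>.  Hence the norms of the entries of \<open>E x\<close> and of \<open>E (T x)\<close> agree up to
  constants, and frame bounds for \<open>\<Lambda>\<close> and for \<open>T \<circ> \<Lambda>\<close> can be computed from each other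
  (\<open>E_g_frame_comp_iff\<close>).  For each single \<open>m \<ge> 1\<close>, statement (i) is therefore equivalent to the frame
  property of \<open>\<Lambda>\<^sub>n + (U ^^ m) \<Lambda>\<^sub>n\<close>, and the three-way equivalence is a matter of quantifiers.

  The point that needs care is the passage from \<open>T \<circ> \<Lambda>\<close> back to \<open>\<Lambda>\<close>: the series \<open>(E x)\<^sub>n\<close> must be
  shown to converge knowing only that \<open>(E (T x))\<^sub>n\<close> does.  The lower bound on \<open>T\<close> gives this through
  the Cauchy criterion (\<open>summable_bounded_below_iff\<close>).
\<close>

text \<open>
  A lower bound on \<open>T\<close> turns Cauchy tails of \<open>\<Sum> T (x k)\<close> into Cauchy tails of \<open>\<Sum> x k\<close>;
  the limit exists because the domain is complete.
\<close>

lemma summable_bounded_below_iff: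
  fixes T :: "'a::banach \<Rightarrow> 'b::banach"
  assumes T: "bounded_linear T" and c: "c > 0" "\<And>y. c * norm y \<le> norm (T y)"
  shows "summable (\<lambda>k. T (x k)) \<longleftrightarrow> summable x"
proof
  assume s: "summable (\<lambda>k. T (x k))"
  show "summable x"
    unfolding summable_Cauchy
  proof (intro allI impI)
    fix e :: real assume "e > 0"
    with c(1) have "c * e > 0" by simp
    with s obtain N where N: "\<And>m n. m \<ge> N \<Longrightarrow> norm (\<Sum>k=m..<n. T (x k)) < c * e"
      unfolding summable_Cauchy by blast
    have "norm (sum x {m..<n}) < e" if "m \<ge> N" for m n
    proof -
      have "c * norm (sum x {m..<n}) \<le> norm (T (sum x {m..<n}))" by (rule c(2))
      also have "\<dots> = norm (\<Sum>k=m..<n. T (x k))"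
        by (simp only: linear_sum[OF bounded_linear.linear[OF T]])
      also have "\<dots> < c * e" using N that by blast
      finally show ?thesis using c(1) by simp
    qed
    then show "\<exists>N. \<forall>m\<ge>N. \<forall>n. norm (sum x {m..<n}) < e" by blast
  qed
next
  assume "summable x"
  then show "summable (\<lambda>k. T (x k))" by (rule bounded_linear.summable[OF T])
qed

lemma bounded_ops_scale:
  assumes "T \<in> bounded_ops smul M"
  shows "T (smul c x) = smul c (T x)"
proof -
  have "module_hom smul smul T"
    using assms by (simp add: bounded_ops_def linear_iff_module_hom)
  then show ?thesis by (rule module_hom.scale)
qed

text \<open>
  The rows of the matrix mapping are infinite linear combinations, so they commute with continuous
  linear operators as soon as they converge; the lower bound makes convergence an equivalence.
\<close>

lemma matrix_map_bounded_below:
  assumes T: "T \<in> bounded_ops smul UNIV" and c: "c > 0" "\<And>y. c * norm y \<le> norm (T y)"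
  shows matrix_map_defined_bounded_below_iff:
      "matrix_map_defined smul E (\<lambda>k. T (x k)) \<longleftrightarrow> matrix_map_defined smul E x"
    and matrix_map_commutes:
      "matrix_map_defined smul E x \<Longrightarrow>
         matrix_map smul E (\<lambda>k. T (x k)) n = T (matrix_map smul E x n)"
proof -
  have bl: "bounded_linear T" using T by (simp add: bounded_ops_def)
  have sc: "smul a (T y) = T (smul a y)" for a y
    using bounded_ops_scale[OF T] by simp
  show "matrix_map_defined smul E (\<lambda>k. T (x k)) \<longleftrightarrow> matrix_map_defined smul E x"
    unfolding matrix_map_defined_def sc
    using summable_bounded_below_iff[OF bl c] by simp
  show "matrix_map smul E (\<lambda>k. T (x k)) n = T (matrix_map smul E x n)"
    if "matrix_map_defined smul E x"
    unfolding matrix_map_def sc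
    using bounded_linear.suminf[OF bl] that by (simp add: matrix_map_defined_def)
qed

text \<open>
  Two families of nonnegative series with termwise comparable entries satisfy frame inequalities
  simultaneously.  The hypotheses are symmetric in the two families, up to inverting the constants,
  so that one implication serves for both directions.
\<close>

lemma frame_bounds_comparable:
  fixes a b :: "'f::real_normed_vector \<Rightarrow> nat \<Rightarrow> real"
  assumes "L > 0" "M > 0" "\<And>f n. 0 \<le> b f n"
    and lower: "\<And>f n. L * a f n \<le> b f n" and upper: "\<And>f n. b f n \<le> M * a f n"
    and frame: "\<exists>A>0. \<exists>B>0. \<forall>f. summable (a f) \<and>
          A * (norm f)\<^sup>2 \<le> (\<Sum>n. a f n) \<and> (\<Sum>n. a f n) \<le> B * (norm f)\<^sup>2"
  shows "\<exists>A>0. \<exists>B>0. \<forall>f. summable (b f) \<and>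
          A * (norm f)\<^sup>2 \<le> (\<Sum>n. b f n) \<and> (\<Sum>n. b f n) \<le> B * (norm f)\<^sup>2"
proof -
  from frame obtain A B where AB: "A > 0" "B > 0"
    and sa: "\<And>f. summable (a f)"
    and lo: "\<And>f. A * (norm f)\<^sup>2 \<le> (\<Sum>n. a f n)"
    and up: "\<And>f. (\<Sum>n. a f n) \<le> B * (norm f)\<^sup>2"
    by blast
  have sb: "summable (b f)" for f
    using upper assms(3)
    by (intro summable_comparison_test'[OF summable_mult[OF sa], of 0]) simp
  have "L * A * (norm f)\<^sup>2 \<le> (\<Sum>n. b f n)" for f
  proof -
    have "L * A * (norm f)\<^sup>2 \<le> L * (\<Sum>n. a f n)"
      using lo[of f] \<open>L > 0\<close> by (simp add: mult.assoc)
    also have "\<dots> = (\<Sum>n. L * a f n)" by (rule suminf_mult[OF sa, symmetric])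
    also have "\<dots> \<le> (\<Sum>n. b f n)"
      by (rule suminf_le[OF lower summable_mult[OF sa] sb])
    finally show ?thesis .
  qed
  moreover have "(\<Sum>n. b f n) \<le> M * B * (norm f)\<^sup>2" for f
  proof -
    have "(\<Sum>n. b f n) \<le> (\<Sum>n. M * a f n)"
      by (rule suminf_le[OF upper sb summable_mult[OF sa]])
    also have "\<dots> = M * (\<Sum>n. a f n)" by (rule suminf_mult[OF sa])
    also have "\<dots> \<le> M * B * (norm f)\<^sup>2"
      using up[of f] \<open>M > 0\<close> by (simp add: mult.assoc)
    finally show ?thesis .
  qed
  moreover have "L * A > 0" "M * B > 0" using AB assms(1,2) by simp_all
  ultimately show ?thesis using sb by blast
qed

text \<open>
  An operator that is bounded above and below distorts the entries of the matrix mapping by bounded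
  factors only, so it preserves and reflects the frame property.
\<close>

lemma E_g_frame_comp_iff:
  assumes T: "T \<in> bounded_ops smul UNIV" and c: "c > 0" "\<And>y. c * norm y \<le> norm (T y)"
    and ops: "\<And>n. \<Lambda> n \<in> bounded_ops smul (H n)" "\<And>n. (\<lambda>f. T (\<Lambda> n f)) \<in> bounded_ops smul (H n)"
  shows "E_g_frame smul E H (\<lambda>n f. T (\<Lambda> n f)) \<longleftrightarrow> E_g_frame smul E H \<Lambda>"
proof (cases "\<forall>f. matrix_map_defined smul E (\<lambda>k. \<Lambda> k f)")
  case False
  then show ?thesis
    unfolding E_g_frame_def matrix_map_defined_bounded_below_iff[OF T c] by blast
next
  case True
  define a where "a f n = (norm (matrix_map smul E (\<lambda>k. \<Lambda> k f) n))\<^sup>2" for f n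
  define b where "b f n = (norm (T (matrix_map smul E (\<lambda>k. \<Lambda> k f) n)))\<^sup>2" for f n
  have frame: "E_g_frame smul E H \<Lambda> \<longleftrightarrow> (\<exists>A>0. \<exists>B>0. \<forall>f. summable (a f) \<and>
      A * (norm f)\<^sup>2 \<le> (\<Sum>n. a f n) \<and> (\<Sum>n. a f n) \<le> B * (norm f)\<^sup>2)"
    unfolding E_g_frame_def a_def using True ops(1) by simp
  have frame_T: "E_g_frame smul E H (\<lambda>n f. T (\<Lambda> n f)) \<longleftrightarrow> (\<exists>A>0. \<exists>B>0. \<forall>f. summable (b f) \<and>
      A * (norm f)\<^sup>2 \<le> (\<Sum>n. b f n) \<and> (\<Sum>n. b f n) \<le> B * (norm f)\<^sup>2)"
    unfolding E_g_frame_def b_def matrix_map_defined_bounded_below_iff[OF T c]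
    using True ops(2) by (simp add: matrix_map_commutes[OF T c])
  have "bounded_linear T" using T by (simp add: bounded_ops_def)
  then obtain K where K: "K > 0" "\<And>y. norm (T y) \<le> norm y * K"
    using bounded_linear.pos_bounded by blast
  have nonneg: "0 \<le> a f n" "0 \<le> b f n" for f n by (simp_all add: a_def b_def)
  have lower: "c\<^sup>2 * a f n \<le> b f n" for f n
    unfolding a_def b_def power_mult_distrib[symmetric]
    by (rule power_mono[OF c(2)]) (simp add: c(1) less_imp_le)
  have upper: "b f n \<le> K\<^sup>2 * a f n" for f n
    unfolding a_def b_def power_mult_distrib[symmetric] mult.commute[of K]
    by (rule power_mono[OF K(2) norm_ge_zero])
  have lower': "(1 / K\<^sup>2) * b f n \<le> a f n" for f n
    using upper[of f n] K(1) by (simp add: divide_le_eq mult.commute)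
  have upper': "a f n \<le> (1 / c\<^sup>2) * b f n" for f n
    using lower[of f n] c(1) by (simp add: le_divide_eq mult.commute)
  have pos: "0 < c\<^sup>2" "0 < K\<^sup>2" "0 < 1 / c\<^sup>2" "0 < 1 / K\<^sup>2" using c(1) K(1) by simp_all
  show ?thesis
    unfolding frame frame_T
    by (rule iffI, erule frame_bounds_comparable[OF pos(4,3) nonneg(1) lower' upper'],
        erule frame_bounds_comparable[OF pos(1,2) nonneg(2) lower upper])
qed

lemma bounded_ops_comp:
  assumes "V \<in> bounded_ops smul UNIV" "V ` M \<subseteq> N" "T \<in> bounded_ops smul M"
  shows "(\<lambda>x. V (T x)) \<in> bounded_ops smul N"
proof -
  have "Vector_Spaces.linear smul smul (V \<circ> T)"
    using assms(1,3) by (intro Vector_Spaces.linear_compose[of smul smul T smul V]) (simp_all add: bounded_ops_def)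
  moreover have "bounded_linear (\<lambda>x. V (T x))"
    using assms(1,3) by (intro bounded_linear_compose[of V T]) (simp_all add: bounded_ops_def)
  moreover have "range (\<lambda>x. V (T x)) \<subseteq> N"
    using assms(2,3) by (auto simp: bounded_ops_def)
  ultimately show ?thesis by (simp add: bounded_ops_def o_def)
qed

lemma bounded_ops_funpow:
  assumes "vector_space smul" "U \<in> bounded_ops smul UNIV"
  shows "U ^^ m \<in> bounded_ops smul UNIV"
proof (induction m)
  case 0
  interpret vector_space smul by fact
  show ?case by (simp add: bounded_ops_def id_def bounded_linear_ident linear_ident)
next
  case (Suc m)
  then show ?case
    using bounded_ops_comp[OF assms(2) subset_UNIV] by (simp add: o_def)
qed

lemma bounded_ops_add:
  assumes "closed_subspace smul M" "vector_space smul"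
    and "S \<in> bounded_ops smul M" "T \<in> bounded_ops smul M"
  shows "(\<lambda>x. S x + T x) \<in> bounded_ops smul M"
proof -
  interpret vector_space_pair smul smul
    using assms(2) by (simp add: vector_space_pair_def)
  have "Vector_Spaces.linear smul smul (\<lambda>x. S x + T x)"
    using assms(3,4) by (intro linear_compose_add) (simp_all add: bounded_ops_def)
  moreover have "bounded_linear (\<lambda>x. S x + T x)"
    using assms(3,4) by (intro bounded_linear_add) (simp_all add: bounded_ops_def)
  moreover have "S x + T x \<in> M" for x
    using assms(1,3,4) by (intro vs1.subspace_add) (auto simp: bounded_ops_def closed_subspace_def)
  ultimately show ?thesis by (auto simp: bounded_ops_def)
qed

lemma invariant_subspace_funpow:
  "invariant_subspace U M \<Longrightarrow> invariant_subspace (U ^^ m) M"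
  by (induction m) (simp_all add: invariant_subspace_def)

lemma norm_funpow_le:
  fixes U :: "'a::real_normed_vector \<Rightarrow> 'a"
  assumes "bounded_linear U"
  shows "norm ((U ^^ m) x) \<le> onorm U ^ m * norm x"
proof (induction m)
  case (Suc m)
  have "norm ((U ^^ Suc m) x) \<le> onorm U * norm ((U ^^ m) x)"
    using onorm[OF assms, of "(U ^^ m) x"] by simp
  also have "\<dots> \<le> onorm U * (onorm U ^ m * norm x)"
    using Suc onorm_pos_le[OF assms] by (rule mult_left_mono)
  finally show ?case by (simp add: mult.assoc)
qed simp

theorem corollary2p10:
  fixes smul :: "'k::rc_field \<Rightarrow> 'h::banach \<Rightarrow> 'h"
    and ip :: "'h \<Rightarrow> 'h \<Rightarrow> 'k"
    and H :: "nat \<Rightarrow> 'h set"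
    and E :: "nat \<Rightarrow> nat \<Rightarrow> 'k"
    and U :: "'h \<Rightarrow> 'h"
    and \<Lambda> :: "nat \<Rightarrow> 'h \<Rightarrow> 'h"
  assumes "infinite_dim_separable_hilbert_space smul ip"
    and "\<And>n. closed_subspace smul (H n)"
    and "invertible_matrix_map smul H E"
    and "U \<in> bounded_ops smul UNIV"
    and "onorm U < sqrt 2 / 2"
    and "\<And>n. invariant_subspace U (H n)"
    and "\<And>n. \<Lambda> n \<in> bounded_ops smul (H n)"
  shows "(E_g_frame smul E H \<Lambda> \<longleftrightarrow>
           (\<forall>m\<ge>1. E_g_frame smul E H (\<lambda>n f. \<Lambda> n f + (U ^^ m) (\<Lambda> n f)))) \<and>
         ((\<forall>m\<ge>1. E_g_frame smul E H (\<lambda>n f. \<Lambda> n f + (U ^^ m) (\<Lambda> n f))) \<longleftrightarrow>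
           (\<exists>m\<ge>1. E_g_frame smul E H (\<lambda>n f. \<Lambda> n f + (U ^^ m) (\<Lambda> n f))))"
proof -
  from assms(1) have vs: "vector_space smul"
    by (simp add: infinite_dim_separable_hilbert_space_def hilbert_space_def)
  have blU: "bounded_linear U" using assms(4) by (simp add: bounded_ops_def)
  have "(sqrt 2 / 2 :: real) < 1" by (simp add: sqrt2_less_2)
  then have U1: "onorm U < 1" using assms(5) by simp
  have U0: "0 \<le> onorm U" by (rule onorm_pos_le[OF blU])
  have UNIV_subspace: "closed_subspace smul UNIV"
    using module.subspace_UNIV[of smul] vs
    by (simp add: closed_subspace_def module_iff_vector_space)
  have iff: "E_g_frame smul E H (\<lambda>n f. \<Lambda> n f + (U ^^ m) (\<Lambda> n f)) \<longleftrightarrow> E_g_frame smul E H \<Lambda>"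
    if "m \<ge> 1" for m
  proof (rule E_g_frame_comp_iff[where c = "1 - onorm U" and T = "\<lambda>y. y + (U ^^ m) y"])
    have Um: "U ^^ m \<in> bounded_ops smul UNIV" by (rule bounded_ops_funpow[OF vs assms(4)])
    have "(\<lambda>y. y) \<in> bounded_ops smul UNIV"
      using bounded_ops_funpow[OF vs assms(4), of 0] by (simp add: id_def)
    from bounded_ops_add[OF UNIV_subspace vs this Um]
    show "(\<lambda>y. y + (U ^^ m) y) \<in> bounded_ops smul UNIV" .
    show "0 < 1 - onorm U" using U1 by simp
    show "(1 - onorm U) * norm y \<le> norm (y + (U ^^ m) y)" for y
    proof -
      have "onorm U ^ m \<le> onorm U"
        using power_decreasing[OF that U0] U1 by simp
      then have "norm ((U ^^ m) y) \<le> onorm U * norm y"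
        using norm_funpow_le[OF blU, of m y] by (meson mult_right_mono norm_ge_zero order_trans)
      then show ?thesis
        using norm_diff_ineq[of y "(U ^^ m) y"] by (simp add: algebra_simps)
    qed
    show "\<Lambda> n \<in> bounded_ops smul (H n)" for n by (rule assms(7))
    show "(\<lambda>f. \<Lambda> n f + (U ^^ m) (\<Lambda> n f)) \<in> bounded_ops smul (H n)" for n
    proof -
      have "(U ^^ m) ` H n \<subseteq> H n"
        using invariant_subspace_funpow[OF assms(6)] by (auto simp: invariant_subspace_def)
      from bounded_ops_add[OF assms(2) vs assms(7) bounded_ops_comp[OF Um this assms(7)]]
      show ?thesis .
    qed
  qed
  then show ?thesis by blast
qed

end
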